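(* Let $H=(V,E,w)$ be a connected weighted hypergraph and let $s\in\mathbb R^V$ with $\mathbf 1^\top s=0$. The problem $$\text{(D)}\qquad\min\{\mathcal D(\eta):\eta\in\mathcal Y,\ B\eta=s\}$$ is equivalent to $$\text{(F)}\qquad\min_{p,n,\mu}\left\{\sum_{e\in E}\frac{\mu_e^2}{2w_e}:\ \begin{array}{l}p_{ev}\ge0,\ n_{ev}\ge0\ (e\in E,\ v\in e),\ \mu_e\ge0\ (e\in E),\\ \sum_{e\ni v}(p_{ev}-n_{ev})=s_v\ (\forall v\in V),\\ \sum_{v\in e}p_{ev}=\mu_e\ (\forall e\in E),\\ \sum_{v\in e}n_{ev}=\mu_e\ (\forall e\in E)\end{array}\right\}$$ in the following sense. (i) Given any feasible $(p,n,\mu)$ for (F), define $(\eta_e)_v:=p_{ev}-n_{ev}$ for $v\in e$ and zero-pad outside $e$. Then $\eta_e\in U_e$ for every $e$, $B\eta=s$, and $\mathcal D(\eta)\le\sum_{e\in E}\frac{\mu_e^2}{2w_e}$. (ii) Given any feasible $\eta$ for (D), define $p_{ev}:=((\eta_e)_v)_+$, $n_{ev}:=((\eta_e)_v)_-$, $\mu_e:=\frac12\|\eta_e\|_1$. Then $(p,n,\mu)$ is feasible for (F), and $\sum_{e\in E}\frac{\mu_e^2}{2w_e}=\mathcal D(\eta)$. Consequently, (F) and (D) have the same optimal value.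
   Context: A weighted hypergraph $H=(V,E,w)$ has a finite vertex set $V$, a finite nonempty family $E$ of nonempty subsets of $V$ (hyperedges), and weights $w_e>0$. It is connected if any two vertices $u,v$ are joined by a sequence $u=p_0,\dots,p_k=v$ of vertices and hyperedges $e_1,\dots,e_k$ with $p_{i-1},p_i\in e_i$. $U_e:=\{\eta\in\mathbb R^V:\operatorname{supp}(\eta)\subseteq e,\ \mathbf 1^\top\eta=0\}$, $\mathcal Y:=\prod_{e\in E}U_e$, $B\eta:=\sum_{e\in E}\eta_e$, $\mathcal D(\eta):=\sum_{e\in E}\frac{\|\eta_e\|_1^2}{8w_e}$. For a real $t$, $t_+:=\max\{t,0\}$ and $t_-:=\max\{-t,0\}$. *)

theory Defs
  imports "HOL-Analysis.Analysis"
begin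

text \<open>
  The finite vertex set is the whole type \<open>'v::finite\<close>, so that \<open>real ^ 'v\<close> is the space of real
  vectors indexed by the vertices. The hyperedge family is a set of vertex sets, hence finite.
  Only the weights of members of \<open>E\<close> are relevant.
\<close>

definition weighted_hypergraph :: "'v::finite set set \<Rightarrow> ('v set \<Rightarrow> real) \<Rightarrow> bool" where
  "weighted_hypergraph E w \<longleftrightarrow> E \<noteq> {} \<and> (\<forall>e\<in>E. e \<noteq> {}) \<and> (\<forall>e\<in>E. w e > 0)"

definition hypergraph_connected :: "'v::finite set set \<Rightarrow> bool" where
  "hypergraph_connected E \<longleftrightarrow>
    (\<forall>u v. \<exists>(k::nat) (p :: nat \<Rightarrow> 'v) (es :: nat \<Rightarrow> 'v set).
       p 0 = u \<and> p k = v \<and>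
       (\<forall>i\<in>{1..k}. es i \<in> E \<and> p (i - 1) \<in> es i \<and> p i \<in> es i))"

definition l1_norm :: "real ^ 'v::finite \<Rightarrow> real" where
  "l1_norm x = (\<Sum>v\<in>UNIV. \<bar>x $ v\<bar>)"

definition edge_space :: "'v::finite set \<Rightarrow> (real ^ 'v) set" where
  "edge_space e = {x. {v. x $ v \<noteq> 0} \<subseteq> e \<and> (\<Sum>v\<in>UNIV. x $ v) = 0}"

definition edge_flows :: "'v::finite set set \<Rightarrow> ('v set \<Rightarrow> real ^ 'v) set" where
  "edge_flows E = (\<Pi>\<^sub>E e\<in>E. edge_space e)"

definition net_flow :: "'v::finite set set \<Rightarrow> ('v set \<Rightarrow> real ^ 'v) \<Rightarrow> real ^ 'v" where
  "net_flow E \<eta> = (\<Sum>e\<in>E. \<eta> e)"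

definition objective_D ::
  "'v::finite set set \<Rightarrow> ('v set \<Rightarrow> real) \<Rightarrow> ('v set \<Rightarrow> real ^ 'v) \<Rightarrow> real" where
  "objective_D E w \<eta> = (\<Sum>e\<in>E. (l1_norm (\<eta> e))\<^sup>2 / (8 * w e))"

definition feasible_D ::
  "'v::finite set set \<Rightarrow> real ^ 'v \<Rightarrow> ('v set \<Rightarrow> real ^ 'v) set" where
  "feasible_D E s = {\<eta> \<in> edge_flows E. net_flow E \<eta> = s}"

definition objective_F ::
  "'v::finite set set \<Rightarrow> ('v set \<Rightarrow> real) \<Rightarrow> ('v set \<Rightarrow> real) \<Rightarrow> real" where
  "objective_F E w \<mu> = (\<Sum>e\<in>E. (\<mu> e)\<^sup>2 / (2 * w e))"

text \<open>
  The variables \<open>p e v\<close>, \<open>n e v\<close> exist only for \<open>e \<in> E\<close>, \<open>v \<in> e\<close>, and \<open>\<mu> e\<close> only for \<open>e \<in> E\<close>.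
  Here they are total functions whose values elsewhere are unconstrained and never used.
\<close>

definition feasible_F ::
  "'v::finite set set \<Rightarrow> real ^ 'v \<Rightarrow>
    (('v set \<Rightarrow> 'v \<Rightarrow> real) \<times> ('v set \<Rightarrow> 'v \<Rightarrow> real) \<times> ('v set \<Rightarrow> real)) set" where
  "feasible_F E s = {(p, n, \<mu>).
     (\<forall>e\<in>E. \<forall>v\<in>e. p e v \<ge> 0 \<and> n e v \<ge> 0) \<and>
     (\<forall>e\<in>E. \<mu> e \<ge> 0) \<and>
     (\<forall>v. (\<Sum>e\<in>{e\<in>E. v \<in> e}. p e v - n e v) = s $ v) \<and>
     (\<forall>e\<in>E. (\<Sum>v\<in>e. p e v) = \<mu> e) \<and>
     (\<forall>e\<in>E. (\<Sum>v\<in>e. n e v) = \<mu> e)}"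

definition flow_of ::
  "'v::finite set set \<Rightarrow> ('v set \<Rightarrow> 'v \<Rightarrow> real) \<Rightarrow> ('v set \<Rightarrow> 'v \<Rightarrow> real) \<Rightarrow>
    ('v set \<Rightarrow> real ^ 'v)" where
  "flow_of E p n = (\<lambda>e\<in>E. \<chi> v. if v \<in> e then p e v - n e v else 0)"

definition pos_of :: "('v set \<Rightarrow> real ^ 'v::finite) \<Rightarrow> 'v set \<Rightarrow> 'v \<Rightarrow> real" where
  "pos_of \<eta> e v = max (\<eta> e $ v) 0"

definition neg_of :: "('v set \<Rightarrow> real ^ 'v::finite) \<Rightarrow> 'v set \<Rightarrow> 'v \<Rightarrow> real" where
  "neg_of \<eta> e v = max (- (\<eta> e $ v)) 0"

definition mass_of :: "('v set \<Rightarrow> real ^ 'v::finite) \<Rightarrow> 'v set \<Rightarrow> real" where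
  "mass_of \<eta> e = l1_norm (\<eta> e) / 2"

text \<open>
  The optimal value is an infimum in \<^typ>\<open>ereal\<close>, so that it is meaningful (and \<open>\<infinity>\<close>) also when
  the feasible set is empty.
\<close>

definition opt_value :: "('a \<Rightarrow> real) \<Rightarrow> 'a set \<Rightarrow> ereal" where
  "opt_value f S = (INF x\<in>S. ereal (f x))"

definition attains_min :: "('a \<Rightarrow> real) \<Rightarrow> 'a set \<Rightarrow> real \<Rightarrow> bool" where
  "attains_min f S c \<longleftrightarrow> (\<exists>x. is_arg_min f (\<lambda>x. x \<in> S) x \<and> f x = c)"

end

theory Submission
  imports Defs
begin

text \<open>
  Netting \<open>p - n\<close> cancels mass common to both parts, so by the triangle inequality
  \<open>\<parallel>\<eta>\<^sub>e\<parallel>\<^sub>1 \<le> 2 \<mu>\<^sub>e\<close>, with equality when \<open>p\<close> and \<open>n\<close> are the positive and negative parts of a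
  zero-sum vector. Thus every feasible point of either problem is matched by a feasible point of the
  other whose cost is no larger, which forces equal infima and equal attained minima.
\<close>

lemma opt_value_le:
  assumes "\<And>y. y \<in> T \<Longrightarrow> \<exists>x\<in>S. f x \<le> g y"
  shows "opt_value f S \<le> opt_value g T"
  unfolding opt_value_def using assms by (intro INF_mono) auto

text \<open>A minimizer in \<open>S\<close> is matched by a point of \<open>T\<close> costing at
  most \<open>c\<close>, while matching in the other direction bounds \<open>g\<close> on
  \<open>T\<close> below by \<open>c\<close>; the matched point is squeezed to cost exactly
  \<open>c\<close>. The assumptions on \<open>S\<close> and \<open>T\<close> are symmetric, so
  swapping roles yields the converse.\<close>

lemma attains_min_transfer:
  assumes "\<And>x. x \<in> S \<Longrightarrow> \<exists>y\<in>T. g y \<le> f x"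
    and "\<And>y. y \<in> T \<Longrightarrow> \<exists>x\<in>S. f x \<le> g y"
    and "attains_min f S c"
  shows "attains_min g T c"
proof -
  \<comment> \<open>\<open>is_arg_min\<close> only excludes strictly smaller values; linearity of
    the order on the reals turns this into a lower bound.\<close>
  obtain x where x: "x \<in> S" "f x = c" "\<And>x'. x' \<in> S \<Longrightarrow> c \<le> f x'"
    using assms(3) by (fastforce simp: attains_min_def is_arg_min_def not_less)
  have lower: "c \<le> g y" if "y \<in> T" for y
    using assms(2)[OF that] x(3) by force
  obtain y where y: "y \<in> T" "g y \<le> c"
    using assms(1)[OF x(1)] x(2) by blast
  with lower have "g y = c"
    by (simp add: order_antisym)
  then show ?thesis
    using y(1) lower by (auto simp: attains_min_def is_arg_min_def not_less)
qed

text \<open>Bridges two conventions: the norm and the zero-sum condition range over all vertices,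
  the constraints of (F) only over \<open>e\<close>.\<close>

lemma sum_UNIV_supported:
  fixes f :: "'v::finite \<Rightarrow> 'a::comm_monoid_add"
  assumes "\<And>v. v \<notin> e \<Longrightarrow> f v = 0"
  shows "sum f UNIV = sum f e"
  using assms by (intro sum.mono_neutral_right) auto

lemma edge_space_supported: "x \<in> edge_space e \<Longrightarrow> v \<notin> e \<Longrightarrow> x $ v = 0"
  by (auto simp: edge_space_def)

lemma edge_space_sum_edge: "x \<in> edge_space e \<Longrightarrow> (\<Sum>v\<in>e. x $ v) = 0"
  using sum_UNIV_supported[of e "\<lambda>v. x $ v"] by (auto simp: edge_space_def)

lemma edge_space_l1_norm: "x \<in> edge_space e \<Longrightarrow> l1_norm x = (\<Sum>v\<in>e. \<bar>x $ v\<bar>)"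
  unfolding l1_norm_def by (rule sum_UNIV_supported) (simp add: edge_space_supported)

lemma flow_of_nth:
  "e \<in> E \<Longrightarrow> flow_of E p n e $ v = (if v \<in> e then p e v - n e v else 0)"
  by (simp add: flow_of_def)

lemma flow_of_edge_space:
  assumes "(p, n, \<mu>) \<in> feasible_F E s" and "e \<in> E"
  shows "flow_of E p n e \<in> edge_space e"
proof -
  have "(\<Sum>v\<in>UNIV. flow_of E p n e $ v) = (\<Sum>v\<in>e. flow_of E p n e $ v)"
    using assms(2) by (intro sum_UNIV_supported) (simp add: flow_of_nth)
  also have "\<dots> = (\<Sum>v\<in>e. p e v - n e v)"
    using assms(2) by (simp add: flow_of_nth)
  \<comment> \<open>Over \<open>e\<close>, both \<open>p\<close> and \<open>n\<close> sum to the
    same \<open>\<mu> e\<close>.\<close>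
  also have "\<dots> = 0"
    using assms by (simp add: feasible_F_def sum_subtractf)
  finally show ?thesis
    using assms(2) by (auto simp: edge_space_def flow_of_nth)
qed

lemma flow_of_feasible_D:
  assumes "(p, n, \<mu>) \<in> feasible_F E s"
  shows "flow_of E p n \<in> feasible_D E s"
proof -
  have "net_flow E (flow_of E p n) $ v = s $ v" for v
  proof -
    have "net_flow E (flow_of E p n) $ v = (\<Sum>e\<in>E. if v \<in> e then p e v - n e v else 0)"
      by (simp add: net_flow_def flow_of_nth)
    also have "\<dots> = (\<Sum>e\<in>{e\<in>E. v \<in> e}. p e v - n e v)"
      by (simp add: sum.inter_filter)
    finally show ?thesis
      using assms by (simp add: feasible_F_def)
  qed
  \<comment> \<open>The extensional product also asks for \<open>undefined\<close> outside
    \<open>E\<close>, which the restricted lambda in \<open>flow_of\<close> supplies.\<close>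
  moreover have "flow_of E p n \<in> edge_flows E"
    using flow_of_edge_space[OF assms] by (simp add: edge_flows_def PiE_iff flow_of_def)
  ultimately show ?thesis
    by (simp add: feasible_D_def vec_eq_iff)
qed

lemma flow_of_l1_norm_le:
  assumes "(p, n, \<mu>) \<in> feasible_F E s" and "e \<in> E"
  shows "l1_norm (flow_of E p n e) \<le> 2 * \<mu> e"
proof -
  have "l1_norm (flow_of E p n e) = (\<Sum>v\<in>e. \<bar>p e v - n e v\<bar>)"
    using assms(2) by (simp add: edge_space_l1_norm[OF flow_of_edge_space[OF assms]] flow_of_nth)
  \<comment> \<open>Nonnegativity of both parts is what bounds the absolute difference by the
    sum.\<close>
  also have "\<dots> \<le> (\<Sum>v\<in>e. p e v + n e v)"
    using assms by (intro sum_mono) (auto simp: feasible_F_def abs_le_iff)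
  also have "\<dots> = 2 * \<mu> e"
    using assms by (simp add: feasible_F_def sum.distrib)
  finally show ?thesis .
qed

lemma objective_D_flow_of_le:
  assumes "(p, n, \<mu>) \<in> feasible_F E s" and "\<And>e. e \<in> E \<Longrightarrow> w e \<ge> 0"
  shows "objective_D E w (flow_of E p n) \<le> objective_F E w \<mu>"
  unfolding objective_D_def objective_F_def
proof (rule sum_mono)
  fix e assume e: "e \<in> E"
  have "(l1_norm (flow_of E p n e))\<^sup>2 \<le> (2 * \<mu> e)\<^sup>2"
    using flow_of_l1_norm_le[OF assms(1) e]
    by (intro power_mono) (auto simp: l1_norm_def sum_nonneg)
  then have "(l1_norm (flow_of E p n e))\<^sup>2 / (8 * w e) \<le> (2 * \<mu> e)\<^sup>2 / (8 * w e)"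
    using assms(2)[OF e] by (intro divide_right_mono) auto
  \<comment> \<open>Squaring \<open>2 * \<mu> e\<close> gives a factor 4, which reduces the 8 in the
    denominator to 2.\<close>
  then show "(l1_norm (flow_of E p n e))\<^sup>2 / (8 * w e) \<le> (\<mu> e)\<^sup>2 / (2 * w e)"
    by (simp add: power_mult_distrib)
qed

lemma parts_feasible_F:
  assumes "\<eta> \<in> feasible_D E s"
  shows "(pos_of \<eta>, neg_of \<eta>, mass_of \<eta>) \<in> feasible_F E s"
proof -
  have U: "\<eta> e \<in> edge_space e" if "e \<in> E" for e
    using assms that by (auto simp: feasible_D_def edge_flows_def)
  \<comment> \<open>In this form the difference of the parts is visibly the entry itself, and sums
    of either part split linearly.\<close>
  have parts: "pos_of \<eta> e v = (\<bar>\<eta> e $ v\<bar> + \<eta> e $ v) / 2"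
    "neg_of \<eta> e v = (\<bar>\<eta> e $ v\<bar> - \<eta> e $ v) / 2" for e v
    by (simp_all add: pos_of_def neg_of_def max_def)
  have "(\<Sum>e\<in>{e\<in>E. v \<in> e}. pos_of \<eta> e v - neg_of \<eta> e v) = s $ v" for v
  proof -
    have "(\<Sum>e\<in>{e\<in>E. v \<in> e}. pos_of \<eta> e v - neg_of \<eta> e v) = (\<Sum>e\<in>{e\<in>E. v \<in> e}. \<eta> e $ v)"
      by (simp add: parts field_simps)
    \<comment> \<open>Hyperedges missing \<open>v\<close> contribute zero by the support
      condition.\<close>
    also have "\<dots> = (\<Sum>e\<in>E. \<eta> e $ v)"
      using edge_space_supported[OF U] by (intro sum.mono_neutral_left) auto
    also have "\<dots> = s $ v"
      using assms by (auto simp: feasible_D_def net_flow_def)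
    finally show ?thesis .
  qed
  \<comment> \<open>The linear terms cancel because the entries of \<open>\<eta> e\<close> sum to
    zero, leaving half the norm in both cases.\<close>
  moreover have "sum (pos_of \<eta> e) e = mass_of \<eta> e" "sum (neg_of \<eta> e) e = mass_of \<eta> e"
    if "e \<in> E" for e
    using edge_space_sum_edge[OF U[OF that]] edge_space_l1_norm[OF U[OF that]]
    by (simp_all add: parts mass_of_def sum.distrib sum_subtractf flip: sum_divide_distrib)
  moreover have "pos_of \<eta> e v \<ge> 0" "neg_of \<eta> e v \<ge> 0" "mass_of \<eta> e \<ge> 0" for e v
    by (simp_all add: pos_of_def neg_of_def mass_of_def l1_norm_def sum_nonneg)
  ultimately show ?thesis
    by (simp add: feasible_F_def)
qed

lemma objective_F_mass_of: "objective_F E w (mass_of \<eta>) = objective_D E w \<eta>"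
  by (simp add: objective_F_def objective_D_def mass_of_def power_divide)

theorem proposition3p1:
  fixes E :: "'v::finite set set" and w :: "'v set \<Rightarrow> real" and s :: "real ^ 'v"
  assumes "weighted_hypergraph E w"
    and "hypergraph_connected E"
    and "(\<Sum>v\<in>UNIV. s $ v) = 0"
  shows
    "(\<forall>p n \<mu>. (p, n, \<mu>) \<in> feasible_F E s \<longrightarrow>
        (\<forall>e\<in>E. flow_of E p n e \<in> edge_space e) \<and>
        net_flow E (flow_of E p n) = s \<and>
        objective_D E w (flow_of E p n) \<le> objective_F E w \<mu>) \<and>
     (\<forall>\<eta>. \<eta> \<in> feasible_D E s \<longrightarrow>
        (pos_of \<eta>, neg_of \<eta>, mass_of \<eta>) \<in> feasible_F E s \<and>
        objective_F E w (mass_of \<eta>) = objective_D E w \<eta>) \<and>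
     opt_value (\<lambda>(p, n, \<mu>). objective_F E w \<mu>) (feasible_F E s)
       = opt_value (objective_D E w) (feasible_D E s) \<and>
     (\<forall>c. attains_min (\<lambda>(p, n, \<mu>). objective_F E w \<mu>) (feasible_F E s) c
        \<longleftrightarrow> attains_min (objective_D E w) (feasible_D E s) c)"
proof -
  let ?F = "\<lambda>(p, n, \<mu>). objective_F E w \<mu>"
  have w: "w e \<ge> 0" if "e \<in> E" for e
    using assms(1) that by (auto simp: weighted_hypergraph_def intro: less_imp_le)
  \<comment> \<open>The witness is the netted flow; in the converse \<open>DF\<close> it is the
    triple of parts, where the costs even agree.\<close>
  have FD: "\<exists>\<eta>\<in>feasible_D E s. objective_D E w \<eta> \<le> ?F x"
    if "x \<in> feasible_F E s" for x
    using that flow_of_feasible_D objective_D_flow_of_le[OF _ w] by (cases x) fastforce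
  have DF: "\<exists>x\<in>feasible_F E s. ?F x \<le> objective_D E w \<eta>"
    if "\<eta> \<in> feasible_D E s" for \<eta>
    using parts_feasible_F[OF that] by (intro bexI) (auto simp: objective_F_mass_of)
  have "opt_value ?F (feasible_F E s) = opt_value (objective_D E w) (feasible_D E s)"
    by (intro order_antisym opt_value_le FD DF)
  moreover have "attains_min ?F (feasible_F E s) c
      \<longleftrightarrow> attains_min (objective_D E w) (feasible_D E s) c" for c
    using attains_min_transfer[OF FD DF] attains_min_transfer[OF DF FD] by blast
  moreover have "net_flow E (flow_of E p n) = s" if "(p, n, \<mu>) \<in> feasible_F E s" for p n \<mu>
    using flow_of_feasible_D[OF that] by (simp add: feasible_D_def)
  moreover have "objective_D E w (flow_of E p n) \<le> objective_F E w \<mu>"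
    if "(p, n, \<mu>) \<in> feasible_F E s" for p n \<mu>
    using that w by (rule objective_D_flow_of_le)
  ultimately show ?thesis
    by (intro conjI allI impI ballI)
      (auto intro: flow_of_edge_space parts_feasible_F simp: objective_F_mass_of)
qed

end
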